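(* Let assumptions (A1)-(A4) of the context hold, assume the system is Lyapunov stable with $d\ge 1$, and let $\epsilon\in(0,1)$. Let $k\in\{1,\dots,N-1\}$ and let $\Omega_k^\epsilon$ be described by $\Omega_k^\epsilon=\{x\in\mathbb{R}^n: H_kx\le h_k\}$ for a finite-dimensional matrix $H_k$ and vector $h_k$. Then $\Omega_{k-1}^\epsilon$ can be described by $\Omega_{k-1}^\epsilon=\{x\in\mathbb{R}^n: H_{k-1}x\le h_{k-1}\}$, where $$H_{k-1}=\begin{bmatrix}S_{k-1}C_{k-1}\\ H_kA_{k-1}\end{bmatrix},\qquad h_{k-1}=\begin{bmatrix}\mathbf{1}\\ h_k\end{bmatrix}.$$ For $k=0$ the same holds with $k-1$ replaced by $N-1$: if $\Omega_0^\epsilon=\{x: H_0x\le h_0\}$ with $H_0,h_0$ finite-dimensional, then $\Omega_{N-1}^\epsilon=\{x: H_{N-1}x\le h_{N-1}\}$ with $H_{N-1}=\begin{bmatrix}S_{N-1}C_{N-1}\\ H_0A_{N-1}\end{bmatrix}$, $h_{N-1}=\begin{bmatrix}\mathbf{1}\\ h_0\end{bmatrix}$.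
   Context: Setting. Let $N\ge 1$ be an integer. Consider the discrete-time $N$-periodic system $x(t+1)=A(t)x(t)$, $y(t)=C(t)x(t)$, $t\in\mathbb{Z}^+=\{0,1,2,\dots\}$, with $x(t)\in\mathbb{R}^n$, $y(t)\in\mathbb{R}^p$, real matrices $A(t)\in\mathbb{R}^{n\times n}$, $C(t)\in\mathbb{R}^{p\times n}$, $A(t+N)=A(t)$, $C(t+N)=C(t)$. Write $A_k=A(k)$, $C_k=C(k)$ for $k=0,\dots,N-1$. The output is required to satisfy $y(t)\in\mathbb{Y}_{t \bmod N}$. Vector inequalities are componentwise, and $\mathbf{1}$ is the all-ones vector of appropriate dimension. Lifted matrices: $\Phi=A_{N-1}\cdots A_1A_0$; $C$ is the block column with blocks $C_0,\ C_1A_0,\ \dots,\ C_{N-1}A_{N-2}\cdots A_0$; $S=\mathrm{blockdiag}(S_0,\dots,S_{N-1})$. Assumptions. (A1) There is $d\in\mathbb{Z}^+$ such that for all $k$, $A_k=\begin{bmatrix}A_{k,s}&A_{k,c}\\ \mathbf{0}&I_d\end{bmatrix}$, $C_k=[C_{k,s}\ \ C_{k,c}]$. Consequently $\Phi=\begin{bmatrix}\Phi_s&\Phi_c\\ \mathbf{0}&I_d\end{bmatrix}$, $C=[C_s\ \ C_c]$, partitioned consistently. (A2) All eigenvalues of $\Phi_s$ lie in the open unit disk (this implies Lyapunov stability of the periodic system). (A3) The pair $(C,\Phi)$ is observable. (A4) For each $k$, $\mathbb{Y}_k=\{y\in\mathbb{R}^p: S_ky\le\mathbf{1}\}$ is compact,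 where $S_k\in\mathbb{R}^{q_k\times p}$. Definitions. For $k\in\{0,\dots,N-1\}$, $\Omega_k$ is the set of all $x_0\in\mathbb{R}^n$ such that the solution with $x(k)=x_0$ satisfies $y(t)\in\mathbb{Y}_{t \bmod N}$ for all $t\ge k$. Let $\Gamma=[\mathbf{0}\quad C_s(I-\Phi_s)^{-1}\Phi_c+C_c]$ (zero block with $n-d$ columns), $\Omega_{ss}^\epsilon=\{x_0\in\mathbb{R}^n: S\Gamma x_0\le(1-\epsilon)\mathbf{1}\}$, and $\Omega_k^\epsilon=\Omega_{ss}^\epsilon\cap\Omega_k$. *)

theory Defs
  imports
    "HOL-Analysis.L2_Norm"
    "HOL-Analysis.Abstract_Metric_Spaces"
    "Jordan_Normal_Form.Char_Poly"
    "Jordan_Normal_Form.Gauss_Jordan_Elimination"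
begin

hide_type (open) Finite_Cartesian_Product.vec
hide_const (open) Finite_Cartesian_Product.vec Finite_Cartesian_Product.mat
unbundle no vec_syntax

definition ones :: "nat \<Rightarrow> real vec" where
  "ones m = vec m (\<lambda>_. 1)"

text \<open>The order on \<^typ>\<open>real vec\<close> is componentwise.\<close>

definition halfspaces :: "real mat \<Rightarrow> real vec \<Rightarrow> real vec set" where
  "halfspaces H h = {x \<in> carrier_vec (dim_col H). H *\<^sub>v x \<le> h}"

text \<open>\<^typ>\<open>real vec\<close> carries no type-class topology, so \<open>\<real>\<^sup>m\<close> is topologised explicitly.\<close>

definition eucl_norm :: "real vec \<Rightarrow> real" where
  "eucl_norm x = L2_set (\<lambda>i. x $ i) {..<dim_vec x}"

definition eucl_dist :: "nat \<Rightarrow> real vec \<Rightarrow> real vec \<Rightarrow> real" where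
  "eucl_dist m x y = L2_set (\<lambda>i. x $ i - y $ i) {..<m}"

definition eucl_topology :: "nat \<Rightarrow> real vec topology" where
  "eucl_topology m = Metric_space.mtopology (carrier_vec m) (eucl_dist m)"

lemma Metric_space_eucl_dist: "Metric_space (carrier_vec m) (eucl_dist m)"
proof
  fix x y z :: "real vec"
  show "0 \<le> eucl_dist m x y"
    by (simp add: eucl_dist_def)
  show "eucl_dist m x y = eucl_dist m y x"
    by (simp add: eucl_dist_def L2_set_def power2_commute)
  show "eucl_dist m x y = 0 \<longleftrightarrow> x = y" if "x \<in> carrier_vec m" "y \<in> carrier_vec m"
    using that by (auto simp: eucl_dist_def L2_set_eq_0_iff)
  have "eucl_dist m x z = L2_set (\<lambda>i. (x $ i - y $ i) + (y $ i - z $ i)) {..<m}"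
    by (simp add: eucl_dist_def)
  also have "\<dots> \<le> eucl_dist m x y + eucl_dist m y z"
    unfolding eucl_dist_def by (rule L2_set_triangle_ineq)
  finally show "eucl_dist m x z \<le> eucl_dist m x y + eucl_dist m y z" .
qed

text \<open>\<open>trajectory A k x\<^sub>0 j\<close> is the state at time \<open>k + j\<close> of the solution with \<open>x(k) = x\<^sub>0\<close>.\<close>

primrec trajectory :: "(nat \<Rightarrow> real mat) \<Rightarrow> nat \<Rightarrow> real vec \<Rightarrow> nat \<Rightarrow> real vec" where
  "trajectory A k x0 0 = x0"
| "trajectory A k x0 (Suc j) = A (k + j) *\<^sub>v trajectory A k x0 j"

definition lyapunov_stable :: "nat \<Rightarrow> (nat \<Rightarrow> real mat) \<Rightarrow> bool" where
  "lyapunov_stable n A \<longleftrightarrow>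
     (\<forall>k. \<forall>e>0. \<exists>\<delta>>0. \<forall>x0 \<in> carrier_vec n. eucl_norm x0 < \<delta> \<longrightarrow>
        (\<forall>j. eucl_norm (trajectory A k x0 j) < e))"

text \<open>\<open>transition n A j = A\<^bsub>j-1\<^esub> \<cdots> A\<^sub>0\<close>\<close>

primrec transition :: "nat \<Rightarrow> (nat \<Rightarrow> real mat) \<Rightarrow> nat \<Rightarrow> real mat" where
  "transition n A 0 = 1\<^sub>m n"
| "transition n A (Suc j) = A j * transition n A j"

definition lifted_Phi :: "nat \<Rightarrow> nat \<Rightarrow> (nat \<Rightarrow> real mat) \<Rightarrow> real mat" where
  "lifted_Phi N n A = transition n A N"

definition lifted_C :: "nat \<Rightarrow> nat \<Rightarrow> (nat \<Rightarrow> real mat) \<Rightarrow> (nat \<Rightarrow> real mat) \<Rightarrow> real mat" where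
  "lifted_C N n A C = foldr (@\<^sub>r) (map (\<lambda>k. C k * transition n A k) [0..<N]) (0\<^sub>m 0 n)"

definition lifted_S :: "nat \<Rightarrow> (nat \<Rightarrow> real mat) \<Rightarrow> real mat" where
  "lifted_S N S = diag_block_mat (map S [0..<N])"

definition observable :: "nat \<Rightarrow> real mat \<Rightarrow> real mat \<Rightarrow> bool" where
  "observable n C \<Phi> \<longleftrightarrow>
     (\<forall>x \<in> carrier_vec n. \<forall>x' \<in> carrier_vec n.
        (\<forall>j. C *\<^sub>v (\<Phi> ^\<^sub>m j *\<^sub>v x) = C *\<^sub>v (\<Phi> ^\<^sub>m j *\<^sub>v x')) \<longrightarrow> x = x')"

definition has_unit_block :: "nat \<Rightarrow> nat \<Rightarrow> real mat \<Rightarrow> bool" where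
  "has_unit_block n d M \<longleftrightarrow>
     (\<exists>Ms \<in> carrier_mat (n - d) (n - d). \<exists>Mc \<in> carrier_mat (n - d) d.
        M = four_block_mat Ms Mc (0\<^sub>m d (n - d)) (1\<^sub>m d))"

definition Phi_s :: "nat \<Rightarrow> nat \<Rightarrow> nat \<Rightarrow> (nat \<Rightarrow> real mat) \<Rightarrow> real mat" where
  "Phi_s N n d A = (case split_block (lifted_Phi N n A) (n - d) (n - d) of (Ps, Pc, _, _) \<Rightarrow> Ps)"

definition Phi_c :: "nat \<Rightarrow> nat \<Rightarrow> nat \<Rightarrow> (nat \<Rightarrow> real mat) \<Rightarrow> real mat" where
  "Phi_c N n d A = (case split_block (lifted_Phi N n A) (n - d) (n - d) of (Ps, Pc, _, _) \<Rightarrow> Pc)"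

text \<open>Splitting after the last row separates only the columns.\<close>

definition C_s :: "nat \<Rightarrow> nat \<Rightarrow> nat \<Rightarrow> (nat \<Rightarrow> real mat) \<Rightarrow> (nat \<Rightarrow> real mat) \<Rightarrow> real mat" where
  "C_s N n d A C = (let L = lifted_C N n A C in
     case split_block L (dim_row L) (n - d) of (Ls, Lc, _, _) \<Rightarrow> Ls)"

definition C_c :: "nat \<Rightarrow> nat \<Rightarrow> nat \<Rightarrow> (nat \<Rightarrow> real mat) \<Rightarrow> (nat \<Rightarrow> real mat) \<Rightarrow> real mat" where
  "C_c N n d A C = (let L = lifted_C N n A C in
     case split_block L (dim_row L) (n - d) of (Ls, Lc, _, _) \<Rightarrow> Lc)"

text \<open>
  \<open>the\<close> is harmless below: \<open>I - \<Phi>\<^sub>s\<close> is invertible whenever all eigenvalues of \<open>\<Phi>\<^sub>s\<close> lie in the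
  open unit disk. The two blocks without rows turn \<^const>\<open>four_block_mat\<close> into horizontal
  concatenation.
\<close>

definition Gamma_mat ::
  "nat \<Rightarrow> nat \<Rightarrow> nat \<Rightarrow> (nat \<Rightarrow> real mat) \<Rightarrow> (nat \<Rightarrow> real mat) \<Rightarrow> real mat" where
  "Gamma_mat N n d A C =
     (let M = C_s N n d A C * the (mat_inverse (1\<^sub>m (n - d) - Phi_s N n d A)) * Phi_c N n d A
              + C_c N n d A C
      in four_block_mat (0\<^sub>m (dim_row M) (n - d)) M (0\<^sub>m 0 (n - d)) (0\<^sub>m 0 d))"

definition Omega ::
  "nat \<Rightarrow> nat \<Rightarrow> (nat \<Rightarrow> real mat) \<Rightarrow> (nat \<Rightarrow> real mat) \<Rightarrow> (nat \<Rightarrow> real vec set) \<Rightarrow> nat \<Rightarrow> real vec set"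
where
  "Omega N n A C Y k =
     {x0 \<in> carrier_vec n. \<forall>j. C (k + j) *\<^sub>v trajectory A k x0 j \<in> Y ((k + j) mod N)}"

definition Omega_ss ::
  "nat \<Rightarrow> nat \<Rightarrow> nat \<Rightarrow> (nat \<Rightarrow> real mat) \<Rightarrow> (nat \<Rightarrow> real mat) \<Rightarrow> (nat \<Rightarrow> real mat) \<Rightarrow> real
     \<Rightarrow> real vec set"
where
  "Omega_ss N n d A C S \<epsilon> =
     {x0 \<in> carrier_vec n. (lifted_S N S * Gamma_mat N n d A C) *\<^sub>v x0
        \<le> (1 - \<epsilon>) \<cdot>\<^sub>v ones (dim_row (lifted_S N S))}"

definition output_set :: "(nat \<Rightarrow> real mat) \<Rightarrow> nat \<Rightarrow> real vec set" where
  "output_set S k = halfspaces (S k) (ones (dim_row (S k)))"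

definition Omega_eps ::
  "nat \<Rightarrow> nat \<Rightarrow> nat \<Rightarrow> (nat \<Rightarrow> real mat) \<Rightarrow> (nat \<Rightarrow> real mat) \<Rightarrow> (nat \<Rightarrow> real mat) \<Rightarrow> real
     \<Rightarrow> nat \<Rightarrow> real vec set"
where
  "Omega_eps N n d A C S \<epsilon> k = Omega_ss N n d A C S \<epsilon> \<inter> Omega N n A C (output_set S) k"

end

theory Submission
  imports Defs
begin

text \<open>
  A trajectory from \<open>x\<^sub>0\<close> at time \<open>k\<close> is \<open>x\<^sub>0\<close> followed by the trajectory from \<open>A\<^sub>k x\<^sub>0\<close> at time
  \<open>k + 1\<close>. Hence \<open>x\<^sub>0\<close> is admissible at time \<open>k\<close> iff its own output satisfies the constraint and
  \<open>A\<^sub>k x\<^sub>0\<close> is admissible at time \<open>k + 1\<close> (\<open>Omega_unfold\<close>): this is a one-step preimage, which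
  turns the inequalities \<open>H x \<le> h\<close> into \<open>H A\<^sub>k x \<le> h\<close> and stacks \<open>S\<^sub>k C\<^sub>k x \<le> 1\<close> on top.

  For the tightened sets one must see why the steady-state constraint need not be listed again at
  time \<open>k\<close>. The matrix \<open>\<Gamma>\<close> reads only the last \<open>d\<close> coordinates of the state, and the block
  \<open>[0  I]\<close> at the bottom of \<open>A\<^sub>k\<close> leaves these unchanged. So \<open>x\<^sub>0\<close> meets the steady-state constraint
  iff \<open>A\<^sub>k x\<^sub>0\<close> does (\<open>Omega_ss_invariant\<close>), and demanding it of the successor
  already demands it of \<open>x\<^sub>0\<close>. Periodicity identifies time \<open>N\<close> with time \<open>0\<close>, which closes the cycle.
\<close>

lemma trajectory_Suc_shift:
  "trajectory A k x (Suc j) = trajectory A (Suc k) (A k *\<^sub>v x) j"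
  by (induction j) auto

lemma trajectory_periodic:
  assumes "\<And>t. A (t + N) = A t"
  shows "trajectory A (k + N) x j = trajectory A k x j"
proof (induction j)
  case (Suc j)
  have "A (k + N + j) = A (k + j)"
    using assms[of "k + j"] by (simp add: ac_simps)
  then show ?case using Suc by simp
qed simp

lemma Omega_periodic:
  assumes "\<And>t. A (t + N) = A t" and "\<And>t. C (t + N) = C t"
  shows "Omega N n A C Y (k + N) = Omega N n A C Y k"
proof -
  have "C (k + N + j) = C (k + j)" "(k + N + j) mod N = (k + j) mod N" for j
    using assms(2)[of "k + j"] mod_add_self2[of "k + j" N] by (simp_all add: ac_simps)
  then show ?thesis
    unfolding Omega_def by (simp add: trajectory_periodic[of A, OF assms(1)])
qed

lemma Omega_unfold:
  assumes "A k \<in> carrier_mat n n"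
  shows "Omega N n A C Y k =
    {x \<in> carrier_vec n. C k *\<^sub>v x \<in> Y (k mod N) \<and> A k *\<^sub>v x \<in> Omega N n A C Y (Suc k)}"
proof -
  have split: "(\<forall>j. P j) \<longleftrightarrow> P 0 \<and> (\<forall>j. P (Suc j))" for P :: "nat \<Rightarrow> bool"
    by (metis not0_implies_Suc)
  have "(\<forall>j. C (k + j) *\<^sub>v trajectory A k x j \<in> Y ((k + j) mod N)) \<longleftrightarrow>
      C k *\<^sub>v x \<in> Y (k mod N) \<and>
      (\<forall>j. C (Suc k + j) *\<^sub>v trajectory A (Suc k) (A k *\<^sub>v x) j \<in> Y ((Suc k + j) mod N))" for x
    by (subst split) (simp only: trajectory_Suc_shift, simp)
  then show ?thesis
    using assms unfolding Omega_def by (auto intro: mult_mat_vec_carrier)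
qed

lemma mult_mat_vec_cong_zero_columns:
  fixes M :: "'a :: semiring_0 mat"
  assumes "x \<in> carrier_vec (dim_col M)" and "y \<in> carrier_vec (dim_col M)"
    and "\<And>i j. i < dim_row M \<Longrightarrow> j < m \<Longrightarrow> j < dim_col M \<Longrightarrow> M $$ (i, j) = 0"
    and "\<And>j. m \<le> j \<Longrightarrow> j < dim_col M \<Longrightarrow> x $ j = y $ j"
  shows "M *\<^sub>v x = M *\<^sub>v y"
proof (rule eq_vecI)
  fix i assume "i < dim_vec (M *\<^sub>v y)"
  then have i: "i < dim_row M" by simp
  have "M $$ (i, j) * x $ j = M $$ (i, j) * y $ j" if "j < dim_col M" for j
    using assms(3)[OF i, of j] assms(4)[of j] that by (cases "j < m") auto
  then show "(M *\<^sub>v x) $ i = (M *\<^sub>v y) $ i"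
    using i assms(1,2) by (simp add: scalar_prod_def)
qed simp

lemma unit_block_mult_vec_last:
  assumes "has_unit_block n d M" and "d \<le> n" and "x \<in> carrier_vec n"
    and "n - d \<le> j" and "j < n"
  shows "(M *\<^sub>v x) $ j = x $ j"
proof -
  obtain Ms Mc where c: "Ms \<in> carrier_mat (n - d) (n - d)" "Mc \<in> carrier_mat (n - d) d"
    and M: "M = four_block_mat Ms Mc (0\<^sub>m d (n - d)) (1\<^sub>m d)"
    using assms(1) unfolding has_unit_block_def by blast
  have dims: "dim_row M = n" "dim_col M = n"
    using c assms(2) by (auto simp: M)
  have "M $$ (j, i) = (if i = j then 1 else 0)" if "i < n" for i
    using c assms that by (auto simp: M)
  then have "(M *\<^sub>v x) $ j = (\<Sum>i = 0..<n. (if i = j then 1 else 0) * x $ i)"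
    using dims assms by (simp add: scalar_prod_def)
  also have "\<dots> = x $ j"
    using assms(5) by (simp add: if_distrib[of "\<lambda>a. a * _"] cong: if_cong)
  finally show ?thesis .
qed

lemma Gamma_mat_dim_col: "d \<le> n \<Longrightarrow> dim_col (Gamma_mat N n d A C) = n"
  by (simp add: Gamma_mat_def Let_def)

lemma mult_Gamma_mat_zero_columns:
  assumes "d \<le> n" and "i < dim_row L" and "j < n - d"
  shows "(L * Gamma_mat N n d A C) $$ (i, j) = 0"
proof -
  have "Gamma_mat N n d A C $$ (l, j) = 0" if "l < dim_row (Gamma_mat N n d A C)" for l
    using that assms(3) by (simp add: Gamma_mat_def Let_def)
  then show ?thesis
    using assms Gamma_mat_dim_col[OF assms(1), of N A C]
    by (simp add: scalar_prod_def)
qed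

text \<open>
  A matrix with a unit block moves a state only in those coordinates that \<open>\<Gamma>\<close> ignores. From right
  to left, the steady-state constraint survives a step of the system; from left to right, it can be
  recovered from the next state.
\<close>

lemma Omega_ss_invariant:
  assumes "d \<le> n" and "has_unit_block n d M" and "M \<in> carrier_mat n n" and "x \<in> carrier_vec n"
  shows "M *\<^sub>v x \<in> Omega_ss N n d A C S \<epsilon> \<longleftrightarrow> x \<in> Omega_ss N n d A C S \<epsilon>"
proof -
  let ?G = "lifted_S N S * Gamma_mat N n d A C"
  have Mx: "M *\<^sub>v x \<in> carrier_vec n"
    using assms by (auto intro: mult_mat_vec_carrier)
  (* The entries of both products must stay folded, so that the two coordinate lemmas can rewrite
     them. *)
  have "?G *\<^sub>v (M *\<^sub>v x) = ?G *\<^sub>v x"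
    using assms Mx
    by (intro mult_mat_vec_cong_zero_columns[where m = "n - d"])
      (auto simp: Gamma_mat_dim_col mult_Gamma_mat_zero_columns unit_block_mult_vec_last
        simp del: index_mult_mat(1) index_mult_mat_vec)
  then show ?thesis
    using assms(4) Mx by (simp add: Omega_ss_def)
qed

lemma halfspaces_append_rows:
  assumes "G \<in> carrier_mat l n" and "H \<in> carrier_mat m n" and "g \<in> carrier_vec l"
  shows "halfspaces (G @\<^sub>r H) (g @\<^sub>v h) = halfspaces G g \<inter> halfspaces H h"
proof -
  have "dim_col (G @\<^sub>r H) = n"
    using assms by (simp add: append_rows_def)
  moreover have "(G @\<^sub>r H) *\<^sub>v x \<le> g @\<^sub>v h \<longleftrightarrow> G *\<^sub>v x \<le> g \<and> H *\<^sub>v x \<le> h"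
    if "x \<in> carrier_vec n" for x
    using assms that by (rule append_rows_le)
  ultimately show ?thesis
    using assms by (auto simp: halfspaces_def)
qed

lemma halfspaces_mult:
  assumes "H \<in> carrier_mat m n" and "M \<in> carrier_mat n r"
  shows "halfspaces (H * M) h = {x \<in> carrier_vec r. M *\<^sub>v x \<in> halfspaces H h}"
  using assms by (auto simp: halfspaces_def assoc_mult_mat_vec intro: mult_mat_vec_carrier)

text \<open>
  The steady-state constraint on \<open>x\<close> has disappeared from the right-hand side: it is carried by
  \<open>A\<^sub>k x\<close>. Without this the stacked inequalities would need additional rows \<open>S \<Gamma>\<close>.
\<close>

lemma Omega_eps_unfold:
  assumes "d \<le> n" and "has_unit_block n d (A k)" and "A k \<in> carrier_mat n n"
  shows "Omega_eps N n d A C S \<epsilon> k =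
    {x \<in> carrier_vec n. C k *\<^sub>v x \<in> output_set S (k mod N) \<and>
      A k *\<^sub>v x \<in> Omega_eps N n d A C S \<epsilon> (Suc k)}"
  using Omega_ss_invariant[OF assms]
  by (auto simp: Omega_eps_def Omega_unfold[of A k n N C "output_set S", OF assms(3)])

lemma Omega_eps_halfspaces_step:
  assumes "k < N" and "d \<le> n" and "has_unit_block n d (A k)"
    and A: "A k \<in> carrier_mat n n" and C: "C k \<in> carrier_mat p n" and S: "S k \<in> carrier_mat l p"
    and H: "H \<in> carrier_mat m n"
    and next_eq: "Omega_eps N n d A C S \<epsilon> (Suc k) = halfspaces H h"
  shows "Omega_eps N n d A C S \<epsilon> k = halfspaces ((S k * C k) @\<^sub>r (H * A k)) (ones l @\<^sub>v h)"
proof -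
  have "halfspaces ((S k * C k) @\<^sub>r (H * A k)) (ones l @\<^sub>v h) =
      halfspaces (S k * C k) (ones l) \<inter> halfspaces (H * A k) h"
    using A C S H by (intro halfspaces_append_rows) (auto simp: ones_def)
  also have "\<dots> = {x \<in> carrier_vec n. C k *\<^sub>v x \<in> halfspaces (S k) (ones l) \<and>
      A k *\<^sub>v x \<in> halfspaces H h}"
    by (auto simp: halfspaces_mult[OF S C] halfspaces_mult[OF H A])
  also have "\<dots> = Omega_eps N n d A C S \<epsilon> k"
    using assms(1) S by (simp add: Omega_eps_unfold[of d n A k, OF assms(2-4)] next_eq output_set_def)
  finally show ?thesis by simp
qed

theorem theorem4:
  fixes N n p d :: nat and q :: "nat \<Rightarrow> nat"
    and A C S :: "nat \<Rightarrow> real mat" and \<epsilon> :: real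
  assumes N: "N \<ge> 1"
    and A_dim: "\<And>t. A t \<in> carrier_mat n n"
    and C_dim: "\<And>t. C t \<in> carrier_mat p n"
    and A_per: "\<And>t. A (t + N) = A t"
    and C_per: "\<And>t. C (t + N) = C t"
    and S_dim: "\<And>k. k < N \<Longrightarrow> S k \<in> carrier_mat (q k) p"
    and A1: "d \<le> n" "\<And>k. k < N \<Longrightarrow> has_unit_block n d (A k)"
    and A2: "\<And>z. eigenvalue (map_mat complex_of_real (Phi_s N n d A)) z \<Longrightarrow> cmod z < 1"
    and A3: "observable n (lifted_C N n A C) (lifted_Phi N n A)"
    and A4: "\<And>k. k < N \<Longrightarrow> compactin (eucl_topology p) (output_set S k)"
    and stable: "lyapunov_stable n A"
    and d: "d \<ge> 1"
    and eps: "0 < \<epsilon>" "\<epsilon> < 1"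
  shows "(\<forall>k \<in> {1..N - 1}. \<forall>m. \<forall>H \<in> carrier_mat m n. \<forall>h \<in> carrier_vec m.
           Omega_eps N n d A C S \<epsilon> k = halfspaces H h \<longrightarrow>
           Omega_eps N n d A C S \<epsilon> (k - 1) =
             halfspaces ((S (k - 1) * C (k - 1)) @\<^sub>r (H * A (k - 1))) (ones (q (k - 1)) @\<^sub>v h)) \<and>
         (\<forall>m. \<forall>H \<in> carrier_mat m n. \<forall>h \<in> carrier_vec m.
           Omega_eps N n d A C S \<epsilon> 0 = halfspaces H h \<longrightarrow>
           Omega_eps N n d A C S \<epsilon> (N - 1) =
             halfspaces ((S (N - 1) * C (N - 1)) @\<^sub>r (H * A (N - 1))) (ones (q (N - 1)) @\<^sub>v h))"
proof (intro conjI ballI allI impI)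
  note step = Omega_eps_halfspaces_step[of _ N d n A C p S, OF _ A1(1) A1(2) A_dim C_dim S_dim]
  {
    fix k m H h
    assume "k \<in> {1..N - 1}" and "H \<in> carrier_mat m n"
      and "Omega_eps N n d A C S \<epsilon> k = halfspaces H h"
    then show "Omega_eps N n d A C S \<epsilon> (k - 1) =
        halfspaces ((S (k - 1) * C (k - 1)) @\<^sub>r (H * A (k - 1))) (ones (q (k - 1)) @\<^sub>v h)"
      by (intro step) auto
  next
    fix m H h
    assume "H \<in> carrier_mat m n" and "Omega_eps N n d A C S \<epsilon> 0 = halfspaces H h"
    moreover have "Omega_eps N n d A C S \<epsilon> (Suc (N - 1)) = Omega_eps N n d A C S \<epsilon> 0"
      using N Omega_periodic[of A N C n "output_set S" 0, OF A_per C_per]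
      by (simp add: Omega_eps_def)
    ultimately show "Omega_eps N n d A C S \<epsilon> (N - 1) =
        halfspaces ((S (N - 1) * C (N - 1)) @\<^sub>r (H * A (N - 1))) (ones (q (N - 1)) @\<^sub>v h)"
      using N by (intro step) auto
  }
qed

end
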